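(* Let $n\ge2$. For each $l=1,\dots,n$ let $\lambda^{(l)}_1,\dots,\lambda^{(l)}_{k_l}\in\mathbb C$ and $\mu^{(l)}_1,\dots,\mu^{(l)}_{q_l}\in\mathbb C$ be interpolation points with $\{\lambda^{(l)}_j\}\cap\{\mu^{(l)}_i\}=\emptyset$, and let $w_{j_1,\dots,j_n},v_{i_1,\dots,i_n}\in\mathbb C$ ($1\le j_l\le k_l$, $1\le i_l\le q_l$) be data. With the matrices $\Lambda_l,M_l$ ($1\le l\le n$), $W_n,V_n,R_n,L_n$ defined in the context, the $n$-D Loewner matrix $\mathbb L_n\in\mathbb C^{q_1\cdots q_n\times k_1\cdots k_n}$ is the solution of the following set of coupled Sylvester equations with intermediate unknowns $X_1,\dots,X_{n-1}\in\mathbb C^{q_1\cdots q_n\times k_1\cdots k_n}$: $$\begin{aligned} M_nX_1-X_1\Lambda_n&=V_nR_n-L_nW_n,\\ M_{n-1}X_2-X_2\Lambda_{n-1}&=X_1,\\ &\;\;\vdots\\ M_2X_{n-1}-X_{n-1}\Lambda_2&=X_{n-2},\\ M_1\mathbb L_n-\mathbb L_n\Lambda_1&=X_{n-1}.\end{aligned}$$ (For $n=2$ the system consists of the first equation $M_2X_1-X_1\Lambda_2=V_2R_2-L_2W_2$ and the last equation $M_1\mathbb L_2-\mathbb L_2\Lambda_1=X_1$.)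
   Context: Multi-indices $(j_1,\dots,j_n)$ (columns) and $(i_1,\dots,i_n)$ (rows) are ordered lexicographically with the last index varying fastest. The $n$-D Loewner matrix $\mathbb L_n$ has entry, in row $(i_1,\dots,i_n)$ and column $(j_1,\dots,j_n)$, $$\frac{v_{i_1,\dots,i_n}-w_{j_1,\dots,j_n}}{(\mu^{(1)}_{i_1}-\lambda^{(1)}_{j_1})(\mu^{(2)}_{i_2}-\lambda^{(2)}_{j_2})\cdots(\mu^{(n)}_{i_n}-\lambda^{(n)}_{j_n})}.$$ For $l=1,\dots,n$, $$\Lambda_l=I_{k_1}\otimes\cdots\otimes I_{k_{l-1}}\otimes\mathrm{diag}(\lambda^{(l)}_1,\dots,\lambda^{(l)}_{k_l})\otimes I_{k_{l+1}}\otimes\cdots\otimes I_{k_n},$$ $$M_l=I_{q_1}\otimes\cdots\otimes I_{q_{l-1}}\otimes\mathrm{diag}(\mu^{(l)}_1,\dots,\mu^{(l)}_{q_l})\otimes I_{q_{l+1}}\otimes\cdots\otimes I_{q_n}.$$ $W_n\in\mathbb C^{1\times k_1\cdots k_n}$ is the row vector of the $w_{j_1,\dots,j_n}$ and $V_n\in\mathbb C^{q_1\cdots q_n\times1}$ the column vector of the $v_{i_1,\dots,i_n}$, both listed in lexicographic order of their multi-indices with the last index varying fastest; $R_n$ is the all-ones row vector of length $k_1\cdots k_n$, and $L_n$ is the all-ones column vector of length $q_1\cdots q_n$. *)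

theory Defs
  imports "Jordan_Normal_Form.Matrix"
begin

text \<open>
  Conventions: the dimension index \<open>l\<close> ranges over \<open>{1..n}\<close>, and the interpolation points are
  \<open>lam l j\<close> with \<open>1 \<le> j \<le> k l\<close> and \<open>mu l i\<close> with \<open>1 \<le> i \<le> q l\<close>. A multi-index
  \<open>(j\<^sub>1, ..., j\<^sub>n)\<close> is the list of its 1-based entries, so that \<open>j\<^sub>l\<close> is \<open>js ! (l - 1)\<close>. Rows and
  columns of matrices are 0-based.
\<close>

text \<open>
  \<open>product_lists\<close> enumerates lexicographically with the last entry varying fastest;
  the element at position \<open>p\<close> is the multi-index of row or column \<open>p\<close>.
\<close>
definition multi_indices :: "nat \<Rightarrow> (nat \<Rightarrow> nat) \<Rightarrow> nat list list" where
  "multi_indices n k = product_lists (map (\<lambda>l. [1..<Suc (k l)]) [1..<Suc n])"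

definition total_dim :: "nat \<Rightarrow> (nat \<Rightarrow> nat) \<Rightarrow> nat" where
  "total_dim n k = (\<Prod>l = 1..n. k l)"

definition kronecker :: "'a :: semiring_1 mat \<Rightarrow> 'a mat \<Rightarrow> 'a mat" where
  "kronecker A B = mat (dim_row A * dim_row B) (dim_col A * dim_col B)
     (\<lambda>(r, c). A $$ (r div dim_row B, c div dim_col B) * B $$ (r mod dim_row B, c mod dim_col B))"

definition kronecker_list :: "'a :: semiring_1 mat list \<Rightarrow> 'a mat" where
  "kronecker_list As = foldr kronecker As (1\<^sub>m 1)"

text \<open>
  \<open>I \<otimes> \<dots> \<otimes> I \<otimes> diag (x l 1, \<dots>, x l (d l)) \<otimes> I \<otimes> \<dots> \<otimes> I\<close>, with the diagonal factor at position \<open>l\<close>;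
  this is \<open>\<Lambda>\<^sub>l\<close> for \<open>d = k\<close>, \<open>x = lam\<close> and \<open>M\<^sub>l\<close> for \<open>d = q\<close>, \<open>x = mu\<close>.
  The shift by \<open>Suc\<close> reconciles 0-based matrix positions with 1-based points.
\<close>
definition point_mat ::
    "nat \<Rightarrow> (nat \<Rightarrow> nat) \<Rightarrow> (nat \<Rightarrow> nat \<Rightarrow> complex) \<Rightarrow> nat \<Rightarrow> complex mat" where
  "point_mat n d x l = kronecker_list
     (map (\<lambda>s. if s = l then mat_diag (d s) (\<lambda>p. x s (Suc p)) else 1\<^sub>m (d s)) [1..<Suc n])"

definition W_row :: "nat \<Rightarrow> (nat \<Rightarrow> nat) \<Rightarrow> (nat list \<Rightarrow> complex) \<Rightarrow> complex mat" where
  "W_row n k w = mat 1 (total_dim n k) (\<lambda>(r, c). w (multi_indices n k ! c))"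

definition V_col :: "nat \<Rightarrow> (nat \<Rightarrow> nat) \<Rightarrow> (nat list \<Rightarrow> complex) \<Rightarrow> complex mat" where
  "V_col n q v = mat (total_dim n q) 1 (\<lambda>(r, c). v (multi_indices n q ! r))"

definition R_row :: "nat \<Rightarrow> (nat \<Rightarrow> nat) \<Rightarrow> complex mat" where
  "R_row n k = mat 1 (total_dim n k) (\<lambda>_. 1)"

definition L_col :: "nat \<Rightarrow> (nat \<Rightarrow> nat) \<Rightarrow> complex mat" where
  "L_col n q = mat (total_dim n q) 1 (\<lambda>_. 1)"

definition loewner_mat ::
    "nat \<Rightarrow> (nat \<Rightarrow> nat) \<Rightarrow> (nat \<Rightarrow> nat) \<Rightarrow> (nat \<Rightarrow> nat \<Rightarrow> complex) \<Rightarrow> (nat \<Rightarrow> nat \<Rightarrow> complex)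
      \<Rightarrow> (nat list \<Rightarrow> complex) \<Rightarrow> (nat list \<Rightarrow> complex) \<Rightarrow> complex mat" where
  "loewner_mat n k q lam mu w v = mat (total_dim n q) (total_dim n k)
     (\<lambda>(r, c). let is = multi_indices n q ! r; js = multi_indices n k ! c in
        (v is - w js) / (\<Prod>l = 1..n. mu l (is ! (l - 1)) - lam l (js ! (l - 1))))"

text \<open>
  The coupled Sylvester equations for the intermediate unknowns \<open>X 1, \<dots>, X (n - 1)\<close> and the
  final unknown \<open>Y\<close>. The \<open>m\<close>-th equation involves \<open>M\<close> and \<open>\<Lambda>\<close> with index \<open>n + 1 - m\<close>.
  Values of \<open>X\<close> outside \<open>{1..n - 1}\<close> are irrelevant when \<open>n \<ge> 2\<close>.
\<close>
definition solves_sylvester ::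
    "nat \<Rightarrow> (nat \<Rightarrow> nat) \<Rightarrow> (nat \<Rightarrow> nat) \<Rightarrow> (nat \<Rightarrow> nat \<Rightarrow> complex) \<Rightarrow> (nat \<Rightarrow> nat \<Rightarrow> complex)
      \<Rightarrow> (nat list \<Rightarrow> complex) \<Rightarrow> (nat list \<Rightarrow> complex)
      \<Rightarrow> (nat \<Rightarrow> complex mat) \<Rightarrow> complex mat \<Rightarrow> bool" where
  "solves_sylvester n k q lam mu w v X Y \<longleftrightarrow>
     (let M = point_mat n q mu; \<Lambda> = point_mat n k lam in
       (\<forall>m\<in>{1..n - 1}. X m \<in> carrier_mat (total_dim n q) (total_dim n k)) \<and>
       Y \<in> carrier_mat (total_dim n q) (total_dim n k) \<and>
       M n * X 1 - X 1 * \<Lambda> n = V_col n q v * R_row n k - L_col n q * W_row n k w \<and>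
       (\<forall>m\<in>{2..n - 1}. M (n + 1 - m) * X m - X m * \<Lambda> (n + 1 - m) = X (m - 1)) \<and>
       M 1 * Y - Y * \<Lambda> 1 = X (n - 1))"

end

theory Submission
  imports Defs
begin

text \<open>
  Each \<open>M\<^sub>l\<close> and \<open>\<Lambda>\<^sub>l\<close> is a Kronecker product of diagonal matrices, hence diagonal, and its
  entry at the position of a multi-index \<open>(i\<^sub>1, ..., i\<^sub>n)\<close> is the point with index \<open>i\<^sub>l\<close>. A Sylvester
  equation with diagonal coefficients decouples into scalar equations
  \<open>(\<mu> - \<lambda>) x = c\<close>, which are uniquely solvable as the point sets are disjoint. Starting from
  \<open>V R - L W\<close>, whose entries are the numerators \<open>v - w\<close>, the equations successively divide by one
  factor of the denominator of the Loewner matrix, from the last factor to the first.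
\<close>

section \<open>Positions in lexicographic enumerations\<close>

lemma nth_concat_map_Cons:
  assumes "p < length xs * length yss"
  shows "concat (map (\<lambda>x. map (Cons x) yss) xs) ! p =
    xs ! (p div length yss) # yss ! (p mod length yss)"
  using assms
proof (induction xs arbitrary: p)
  case (Cons x xs)
  have pos: "length yss > 0"
    using Cons.prems by (cases "length yss") auto
  show ?case
  proof (cases "p < length yss")
    case False
    \<comment> \<open>All blocks \<open>map (Cons x) yss\<close> have the length of
      \<open>yss\<close>, so dropping the first block lowers the quotient of the position by one and
      keeps its remainder.\<close>
    then have "concat (map (\<lambda>x. map (Cons x) yss) xs) ! (p - length yss) =
        xs ! ((p - length yss) div length yss) # yss ! ((p - length yss) mod length yss)"
      using Cons.prems by (intro Cons.IH) auto
    with False pos show ?thesis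
      by (simp add: nth_append le_div_geq le_mod_geq)
  qed (simp add: nth_append)
qed simp

lemma length_product_lists_prod_list:
  "length (product_lists xss) = prod_list (map length xss)"
  by (induction xss) (simp_all add: length_concat comp_def sum_list_triv)

text \<open>The quotient and remainder here are the ones by which \<open>kronecker\<close> splits
  its indices; this match ties matrix positions to multi-indices.\<close>

lemma product_lists_Cons_nth:
  assumes "p < length xs * length (product_lists xss)"
  shows "product_lists (xs # xss) ! p =
    xs ! (p div length (product_lists xss)) # product_lists xss ! (p mod length (product_lists xss))"
  using nth_concat_map_Cons[OF assms] by simp

section \<open>Kronecker products of diagonal matrices\<close>

lemma kronecker_mat_diag:
  "kronecker (mat_diag m f) (mat_diag n g) = mat_diag (m * n) (\<lambda>p. f (p div n) * g (p mod n))"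
proof (rule eq_matI)
  fix r c
  assume "r < dim_row (mat_diag (m * n) (\<lambda>p. f (p div n) * g (p mod n)))"
    and "c < dim_col (mat_diag (m * n) (\<lambda>p. f (p div n) * g (p mod n)))"
  then have rc: "r < m * n" "c < m * n"
    by (simp_all add: mat_diag_def)
  then have "n > 0"
    by (cases n) auto
  \<comment> \<open>An off-diagonal position thus differs in its quotient or its remainder, and the
    corresponding diagonal factor contributes a zero.\<close>
  moreover have "r = c \<longleftrightarrow> r div n = c div n \<and> r mod n = c mod n"
    by (metis div_mult_mod_eq)
  ultimately show "kronecker (mat_diag m f) (mat_diag n g) $$ (r, c) =
      mat_diag (m * n) (\<lambda>p. f (p div n) * g (p mod n)) $$ (r, c)"
    using rc by (auto simp: kronecker_def mat_diag_def less_mult_imp_div_less)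
qed (simp_all add: kronecker_def mat_diag_def)

lemma mat_diag_cong:
  assumes "\<And>p. p < m \<Longrightarrow> f p = g p"
  shows "mat_diag m f = mat_diag m g"
  using assms by (intro eq_matI) (auto simp: mat_diag_def)

text \<open>Induction on the factors: the head factor sees the quotient of the position, the tail
  the remainder, exactly as in \<open>product_lists_Cons_nth\<close>. Allowing a function
  \<open>f s\<close> in every factor covers identity factors too, by a constant 1.\<close>

lemma kronecker_list_mat_diag:
  "kronecker_list (map (\<lambda>s. mat_diag (d s) (\<lambda>p. f s (Suc p))) ls) =
   mat_diag (prod_list (map d ls))
     (\<lambda>p. \<Prod>i<length ls. f (ls ! i) (product_lists (map (\<lambda>s. [1..<Suc (d s)]) ls) ! p ! i))"
proof (induction ls)
  case Nil
  show ?case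
    by (simp add: kronecker_list_def flip: mat_diag_one)
next
  case (Cons s ls)
  let ?ps = "product_lists (map (\<lambda>s. [1..<Suc (d s)]) ls)"
  let ?N = "prod_list (map d ls)"
  have len: "length ?ps = ?N"
    by (simp add: length_product_lists_prod_list comp_def del: upt_Suc)
  have "kronecker_list (map (\<lambda>s. mat_diag (d s) (\<lambda>p. f s (Suc p))) (s # ls)) =
      mat_diag (d s * ?N) (\<lambda>p. f s (Suc (p div ?N)) *
        (\<Prod>i<length ls. f (ls ! i) (?ps ! (p mod ?N) ! i)))"
    using Cons.IH by (simp add: kronecker_list_def kronecker_mat_diag)
  also have "\<dots> = mat_diag (d s * ?N)
     (\<lambda>p. \<Prod>i<length (s # ls).
        f ((s # ls) ! i) (product_lists (map (\<lambda>s. [1..<Suc (d s)]) (s # ls)) ! p ! i))"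
  proof (rule mat_diag_cong)
    fix p
    assume p: "p < d s * ?N"
    have "product_lists (map (\<lambda>s. [1..<Suc (d s)]) (s # ls)) ! p =
        [1..<Suc (d s)] ! (p div ?N) # ?ps ! (p mod ?N)"
      using product_lists_Cons_nth[of p "[1..<Suc (d s)]" "map (\<lambda>s. [1..<Suc (d s)]) ls"]
        p len by (simp del: upt_Suc product_lists.simps)
    also have "[1..<Suc (d s)] ! (p div ?N) = Suc (p div ?N)"
      using less_mult_imp_div_less[OF p] by (simp del: upt_Suc)
    finally show "f s (Suc (p div ?N)) * (\<Prod>i<length ls. f (ls ! i) (?ps ! (p mod ?N) ! i)) =
      (\<Prod>i<length (s # ls).
        f ((s # ls) ! i) (product_lists (map (\<lambda>s. [1..<Suc (d s)]) (s # ls)) ! p ! i))"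
      \<comment> \<open>The factor at \<open>i = 0\<close> belongs to \<open>s\<close>; the others,
        shifted by one, belong to \<open>ls\<close>.\<close>
      by (simp add: prod.lessThan_Suc_shift del: prod.lessThan_Suc upt_Suc product_lists.simps)
  qed
  finally show ?case
    by simp
qed

section \<open>Multi-indices and the diagonal form of the coefficient matrices\<close>

lemma total_dim_prod_list: "total_dim n d = prod_list (map d [1..<Suc n])"
  unfolding total_dim_def
  by (simp add: prod.distinct_set_conv_list[symmetric] atLeastLessThanSuc_atLeastAtMost del: upt_Suc)

lemma length_multi_indices: "length (multi_indices n d) = total_dim n d"
  by (simp add: multi_indices_def length_product_lists_prod_list total_dim_prod_list comp_def
      del: upt_Suc)

text \<open>This brings the points selected by a multi-index within reach of the disjointness
  hypothesis, which concerns indices in these ranges only.\<close>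

lemma multi_indices_nth:
  assumes "r < total_dim n d" and "l \<in> {1..n}"
  shows "multi_indices n d ! r ! (l - 1) \<in> {1..d l}"
proof -
  have "multi_indices n d ! r \<in> set (multi_indices n d)"
    using assms(1) by (simp add: length_multi_indices)
  then have "list_all2 (\<lambda>x ys. x \<in> set ys) (multi_indices n d ! r)
      (map (\<lambda>l. [1..<Suc (d l)]) [1..<Suc n])"
    by (simp add: multi_indices_def product_lists_set del: upt_Suc)
  moreover have "l - 1 < n"
    using assms(2) by auto
  ultimately show ?thesis
    using list_all2_nthD2[of _ "multi_indices n d ! r" _ "l - 1"] assms(2)
    by (fastforce simp del: upt_Suc)
qed

text \<open>Identity factors are diagonal with constant entry 1, so the product over all coordinates
  collapses to the factor of coordinate \<open>l\<close>.\<close>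

lemma point_mat_eq_mat_diag:
  assumes "l \<in> {1..n}"
  shows "point_mat n d x l = mat_diag (total_dim n d) (\<lambda>p. x l (multi_indices n d ! p ! (l - 1)))"
proof -
  let ?f = "\<lambda>s j. if s = l then x s j else 1"
  have "(if s = l then mat_diag (d s) (\<lambda>p. x s (Suc p)) else 1\<^sub>m (d s)) =
      mat_diag (d s) (\<lambda>p. ?f s (Suc p))" for s
    by (simp add: mat_diag_one)
  then have "point_mat n d x l =
      kronecker_list (map (\<lambda>s. mat_diag (d s) (\<lambda>p. ?f s (Suc p))) [1..<Suc n])"
    by (simp add: point_mat_def del: upt_Suc)
  also have "\<dots> = mat_diag (total_dim n d)
      (\<lambda>p. \<Prod>i<n. ?f ([1..<Suc n] ! i) (multi_indices n d ! p ! i))"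
    by (simp only: kronecker_list_mat_diag[of d ?f] total_dim_prod_list multi_indices_def
        length_upt diff_Suc_1)
  also have "(\<lambda>p. \<Prod>i<n. ?f ([1..<Suc n] ! i) (multi_indices n d ! p ! i)) =
      (\<lambda>p. x l (multi_indices n d ! p ! (l - 1)))"
  proof
    fix p
    \<comment> \<open>\<open>[1..<Suc n] ! i\<close> is \<open>Suc i\<close>, so \<open>l\<close> is
      met at \<open>i = l - 1\<close>.\<close>
    have "(\<Prod>i<n. ?f ([1..<Suc n] ! i) (multi_indices n d ! p ! i)) =
        (\<Prod>i<n. if i = l - 1 then x l (multi_indices n d ! p ! i) else 1)"
      using assms by (intro prod.cong) (auto simp del: upt_Suc)
    also have "\<dots> = x l (multi_indices n d ! p ! (l - 1))"
      using assms by (simp, arith)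
    finally show "(\<Prod>i<n. ?f ([1..<Suc n] ! i) (multi_indices n d ! p ! i)) =
      x l (multi_indices n d ! p ! (l - 1))" .
  qed
  finally show ?thesis .
qed

section \<open>Sylvester equations with diagonal coefficients and their coupled system\<close>

lemma sylvester_mat_diag_iff:
  fixes X C :: "'a :: field mat"
  assumes X: "X \<in> carrier_mat m n" and C: "C \<in> carrier_mat m n"
    and ne: "\<And>i j. i < m \<Longrightarrow> j < n \<Longrightarrow> a i \<noteq> b j"
  shows "mat_diag m a * X - X * mat_diag n b = C \<longleftrightarrow>
    X = mat m n (\<lambda>(i, j). C $$ (i, j) / (a i - b j))"
proof -
  \<comment> \<open>Left multiplication scales row \<open>i\<close> by \<open>a i\<close>, right
    multiplication scales column \<open>j\<close> by \<open>b j\<close>.\<close>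
  have "mat_diag m a * X - X * mat_diag n b = mat m n (\<lambda>(i, j). (a i - b j) * X $$ (i, j))"
    unfolding mat_diag_mult_left[OF X] mat_diag_mult_right[OF X]
    by (intro eq_matI) (auto simp: algebra_simps)
  moreover have "(a i - b j) * X $$ (i, j) = C $$ (i, j) \<longleftrightarrow> X $$ (i, j) = C $$ (i, j) / (a i - b j)"
    if "i < m" "j < n" for i j
    using ne[OF that] by (auto simp: field_simps)
  ultimately show ?thesis
    using X C by (auto simp: mat_eq_iff)
qed

text \<open>The closed form of the \<open>m\<close>-th unknown: only the last \<open>m\<close>
  factors of the Loewner denominator are present. For \<open>m = 0\<close> the product is empty, for
  \<open>m = n\<close> it is complete.\<close>

definition sylvester_iterate ::
    "nat \<Rightarrow> (nat \<Rightarrow> nat) \<Rightarrow> (nat \<Rightarrow> nat) \<Rightarrow> (nat \<Rightarrow> nat \<Rightarrow> complex) \<Rightarrow> (nat \<Rightarrow> nat \<Rightarrow> complex)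
      \<Rightarrow> (nat list \<Rightarrow> complex) \<Rightarrow> (nat list \<Rightarrow> complex) \<Rightarrow> nat \<Rightarrow> complex mat" where
  "sylvester_iterate n k q lam mu w v m = mat (total_dim n q) (total_dim n k)
     (\<lambda>(r, c). let is = multi_indices n q ! r; js = multi_indices n k ! c in
        (v is - w js) / (\<Prod>l = n + 1 - m..n. mu l (is ! (l - 1)) - lam l (js ! (l - 1))))"

lemma sylvester_iterate_carrier:
  "sylvester_iterate n k q lam mu w v m \<in> carrier_mat (total_dim n q) (total_dim n k)"
  by (simp add: sylvester_iterate_def)

text \<open>Both products on the right have inner dimension 1, so their entries are plain products
  with a factor 1.\<close>

lemma sylvester_iterate_0:
  "sylvester_iterate n k q lam mu w v 0 = V_col n q v * R_row n k - L_col n q * W_row n k w"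
  by (intro eq_matI)
    (auto simp: sylvester_iterate_def V_col_def R_row_def L_col_def W_row_def scalar_prod_def)

lemma sylvester_iterate_n:
  "sylvester_iterate n k q lam mu w v n = loewner_mat n k q lam mu w v"
  by (simp add: sylvester_iterate_def loewner_mat_def)

text \<open>Passing from \<open>m - 1\<close> to \<open>m\<close> adds the factor with index
  \<open>n + 1 - m\<close> to the denominator, which is the divisor that the equation with this
  index imposes.\<close>

lemma sylvester_step_iff:
  assumes disj: "\<And>l. l \<in> {1..n} \<Longrightarrow> lam l ` {1..k l} \<inter> mu l ` {1..q l} = {}"
    and m: "m \<in> {1..n}"
    and X: "X \<in> carrier_mat (total_dim n q) (total_dim n k)"
  shows "point_mat n q mu (n + 1 - m) * X - X * point_mat n k lam (n + 1 - m) =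
      sylvester_iterate n k q lam mu w v (m - 1) \<longleftrightarrow>
    X = sylvester_iterate n k q lam mu w v m"
proof -
  define l where "l = n + 1 - m"
  \<comment> \<open>The previous denominator starts at \<open>Suc l\<close>; for
    \<open>m = 1\<close> this is \<open>n + 1\<close> and its range is empty.\<close>
  have l: "l \<in> {1..n}" and l': "n + 1 - (m - 1) = Suc l"
    using m by (auto simp: l_def)
  have ne: "mu l (multi_indices n q ! i ! (l - 1)) \<noteq> lam l (multi_indices n k ! j ! (l - 1))"
    if "i < total_dim n q" "j < total_dim n k" for i j
    using multi_indices_nth[OF that(1) l] multi_indices_nth[OF that(2) l] disj[OF l] by blast
  have split: "(\<Prod>s = l..n. g s) = g l * (\<Prod>s = Suc l..n. g s)" for g :: "nat \<Rightarrow> complex"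
    using l by (simp add: prod.atLeast_Suc_atMost)
  have "mat (total_dim n q) (total_dim n k) (\<lambda>(i, j).
        sylvester_iterate n k q lam mu w v (m - 1) $$ (i, j) /
          (mu l (multi_indices n q ! i ! (l - 1)) - lam l (multi_indices n k ! j ! (l - 1)))) =
      sylvester_iterate n k q lam mu w v m"
    unfolding sylvester_iterate_def l' l_def[symmetric]
    by (intro eq_matI) (auto simp: Let_def split mult.commute)
  then show ?thesis
    unfolding l_def[symmetric] point_mat_eq_mat_diag[OF l]
    by (subst sylvester_mat_diag_iff[OF X sylvester_iterate_carrier]) (use ne in auto)
qed

text \<open>Each equation determines its unknown from the preceding one, which gives the forward
  direction; conversely the iterates satisfy every link of the chain. The equivalence carries
  existence and uniqueness together.\<close>

lemma solves_sylvester_iff: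
  assumes n: "n \<ge> 2"
    and disj: "\<And>l. l \<in> {1..n} \<Longrightarrow> lam l ` {1..k l} \<inter> mu l ` {1..q l} = {}"
  shows "solves_sylvester n k q lam mu w v X Y \<longleftrightarrow>
    (\<forall>m\<in>{1..n - 1}. X m = sylvester_iterate n k q lam mu w v m) \<and>
    Y = loewner_mat n k q lam mu w v"
proof
  let ?Z = "sylvester_iterate n k q lam mu w v"
  have step: "point_mat n q mu (n + 1 - m) * A - A * point_mat n k lam (n + 1 - m) = ?Z (m - 1) \<longleftrightarrow>
      A = ?Z m"
    if "m \<in> {1..n}" "A \<in> carrier_mat (total_dim n q) (total_dim n k)" for m A
    using disj that by (rule sylvester_step_iff)
  {
    assume sol: "solves_sylvester n k q lam mu w v X Y"
    have car: "X m \<in> carrier_mat (total_dim n q) (total_dim n k)" if "m \<in> {1..n - 1}" for m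
      using sol that by (simp add: solves_sylvester_def Let_def)
    have X: "X m = ?Z m" if "1 \<le> m" "m \<le> n - 1" for m
      using that
    \<comment> \<open>The chain starts at 1, since the right-hand side of the first equation is
      \<open>?Z 0\<close>, not \<open>X 0\<close>.\<close>
    proof (induction m rule: nat_induct_at_least)
      case base
      have "point_mat n q mu n * X 1 - X 1 * point_mat n k lam n = ?Z 0"
        using sol by (simp add: solves_sylvester_def Let_def sylvester_iterate_0)
      then show ?case
        using step[of 1 "X 1"] car[of 1] n by simp
    next
      case (Suc m)
      then have "X m = ?Z m" and m: "Suc m \<in> {2..n - 1}" "Suc m \<in> {1..n - 1}" "Suc m \<in> {1..n}"
        by auto
      moreover have "point_mat n q mu (n + 1 - Suc m) * X (Suc m) -
          X (Suc m) * point_mat n k lam (n + 1 - Suc m) = X (Suc m - 1)"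
        using sol m(1) unfolding solves_sylvester_def Let_def by blast
      ultimately show ?case
        using step[OF m(3) car[OF m(2)]] by simp
    qed
    have "Y \<in> carrier_mat (total_dim n q) (total_dim n k)"
      and "point_mat n q mu 1 * Y - Y * point_mat n k lam 1 = X (n - 1)"
      using sol by (simp_all add: solves_sylvester_def Let_def)
    \<comment> \<open>The last equation is the case \<open>m = n\<close> of \<open>step\<close>, as
      \<open>n + 1 - n = 1\<close>; \<open>n \<ge> 2\<close> places \<open>X (n - 1)\<close> among
      the unknowns already identified.\<close>
    then have "Y = ?Z n"
      using step[of n Y] X[of "n - 1"] n by simp
    with X show "(\<forall>m\<in>{1..n - 1}. X m = ?Z m) \<and> Y = loewner_mat n k q lam mu w v"
      by (simp add: sylvester_iterate_n)
  next
    assume eq: "(\<forall>m\<in>{1..n - 1}. X m = ?Z m) \<and> Y = loewner_mat n k q lam mu w v"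
    \<comment> \<open>The converse reads \<open>step\<close> from right to left with
      \<open>A = ?Z m\<close>.\<close>
    have eqs: "point_mat n q mu (n + 1 - m) * ?Z m - ?Z m * point_mat n k lam (n + 1 - m) = ?Z (m - 1)"
      if "m \<in> {1..n}" for m
      using step[OF that sylvester_iterate_carrier] by blast
    have X: "X m = ?Z m" if "1 \<le> m" "m \<le> n - 1" for m
      using eq that by simp
    have "Y = ?Z n"
      using eq by (simp add: sylvester_iterate_n)
    moreover have "X 1 = ?Z 1" "X (n - 1) = ?Z (n - 1)"
      using X n by simp_all
    moreover have "point_mat n q mu (n + 1 - m) * X m - X m * point_mat n k lam (n + 1 - m) = X (m - 1)"
      if "m \<in> {2..n - 1}" for m
    proof -
      have "X m = ?Z m" "X (m - 1) = ?Z (m - 1)" "m \<in> {1..n}"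
        using that by (auto intro!: X)
      then show ?thesis
        using eqs[of m] by simp
    qed
    \<comment> \<open>The flipped rewriting turns the right-hand side of the first equation into
      \<open>?Z 0\<close>, the form in which \<open>eqs\<close> supplies it.\<close>
    ultimately show "solves_sylvester n k q lam mu w v X Y"
      using eqs[of 1] eqs[of n] n X
      by (simp add: solves_sylvester_def Let_def sylvester_iterate_carrier
          flip: sylvester_iterate_0[of n k q lam mu w v])
  }
qed

theorem theorem4p3:
  fixes n :: nat
    and k q :: "nat \<Rightarrow> nat"
    and lam mu :: "nat \<Rightarrow> nat \<Rightarrow> complex"
    and w v :: "nat list \<Rightarrow> complex"
  assumes "n \<ge> 2"
    and "\<And>l. l \<in> {1..n} \<Longrightarrow> lam l ` {1..k l} \<inter> mu l ` {1..q l} = {}"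
  shows "\<exists>X. solves_sylvester n k q lam mu w v X (loewner_mat n k q lam mu w v) \<and>
    (\<forall>X' Y. solves_sylvester n k q lam mu w v X' Y \<longrightarrow>
       (\<forall>m\<in>{1..n - 1}. X' m = X m) \<and> Y = loewner_mat n k q lam mu w v)"
proof -
  have "solves_sylvester n k q lam mu w v X Y \<longleftrightarrow>
      (\<forall>m\<in>{1..n - 1}. X m = sylvester_iterate n k q lam mu w v m) \<and>
      Y = loewner_mat n k q lam mu w v" for X Y
    using assms by (rule solves_sylvester_iff)
  then show ?thesis
    \<comment> \<open>With the iterates as witness, the equivalence read backwards gives
      solvability, and read forwards uniqueness.\<close>
    by (intro exI[of _ "sylvester_iterate n k q lam mu w v"]) simp
qed

end
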